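(* Let $G=(V,E)$ be a non-complete connected (simple, undirected, locally finite) graph with minimum degree $\delta(G)$ and connectivity $k(G)$. If any two vertices at distance $2$ have at most $\beta$ common neighbors, then $$k(G)\geq 2\delta(G)\,\kappa_{LLY}^{(2)}(G)-\beta.$$
   Context: The connectivity $k(G)$ of a non-complete graph is the minimum number of vertices whose removal disconnects $G$. $d(x,y)$ is the graph distance and $d_x$ the degree of $x$. For $p\in[0,1]$ and a vertex $x$, $\mu_x^p$ is the probability measure with $\mu_x^p(x)=p$, $\mu_x^p(y)=\frac{1-p}{d_x}$ if $y$ is adjacent to $x$, and $0$ otherwise. For probability measures $\mu_1,\mu_2$ on $V$, $W(\mu_1,\mu_2)=\inf_\pi\sum_{x,y}d(x,y)\pi(x,y)$ over all $\pi:V\times V\to[0,1]$ with marginals $\mu_1$ and $\mu_2$. For distinct vertices $x,y$, $\kappa_p(x,y)=1-\frac{W(\mu_x^p,\mu_y^p)}{d(x,y)}$ and $\kappa_{LLY}(x,y)=\lim_{p\to1}\frac{\kappa_p(x,y)}{1-p}$. $\kappa_{LLY}^{(2)}(G)=\inf\{\kappa_{LLY}(x,y): x,y\in V,\ d(x,y)=2\}$. *)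

theory Defs
  imports "HOL-Analysis.Analysis"
begin

text \<open>
  A simple undirected graph is given by a vertex set \<open>V\<close>, possibly infinite, and a symmetric
  irreflexive adjacency relation \<open>E\<close> on \<open>V\<close>.
\<close>

locale locally_finite_graph =
  fixes V :: "'a set" and E :: "'a rel"
  assumes edges_subset: "E \<subseteq> V \<times> V"
    and edges_sym: "sym E"
    and edges_irrefl: "irrefl E"
    and locally_finite: "\<And>x. x \<in> V \<Longrightarrow> finite (E `` {x})"

definition connected_graph :: "'a set \<Rightarrow> 'a rel \<Rightarrow> bool" where
  "connected_graph V E \<longleftrightarrow> (\<forall>x\<in>V. \<forall>y\<in>V. (x, y) \<in> E\<^sup>*)"

definition complete_graph :: "'a set \<Rightarrow> 'a rel \<Rightarrow> bool" where
  "complete_graph V E \<longleftrightarrow> (\<forall>x\<in>V. \<forall>y\<in>V. x \<noteq> y \<longrightarrow> (x, y) \<in> E)"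

definition degree :: "'a rel \<Rightarrow> 'a \<Rightarrow> nat" where
  "degree E x = card (E `` {x})"

definition min_degree :: "'a set \<Rightarrow> 'a rel \<Rightarrow> nat" where
  "min_degree V E = (INF x\<in>V. degree E x)"

definition common_neighbors :: "'a rel \<Rightarrow> 'a \<Rightarrow> 'a \<Rightarrow> 'a set" where
  "common_neighbors E x y = E `` {x} \<inter> E `` {y}"

text \<open>Only meaningful when \<open>y\<close> is reachable from \<open>x\<close>.\<close>

definition graph_dist :: "'a rel \<Rightarrow> 'a \<Rightarrow> 'a \<Rightarrow> nat" where
  "graph_dist E x y = (LEAST n. (x, y) \<in> E ^^ n)"

definition disconnects :: "'a set \<Rightarrow> 'a rel \<Rightarrow> 'a set \<Rightarrow> bool" where
  "disconnects V E S \<longleftrightarrow> S \<subseteq> V \<and> \<not> connected_graph (V - S) (E \<inter> (V - S) \<times> (V - S))"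

text \<open>
  The minimum ranges over finite sets only (an infinite set would have \<open>card\<close> 0). In a
  non-complete locally finite connected graph there is one: the neighbourhood of a vertex \<open>x\<close>
  separates \<open>x\<close> from any vertex at distance 2.
\<close>

definition connectivity :: "'a set \<Rightarrow> 'a rel \<Rightarrow> nat" where
  "connectivity V E = (LEAST n. \<exists>S. finite S \<and> disconnects V E S \<and> card S = n)"

definition lazy_measure :: "'a rel \<Rightarrow> real \<Rightarrow> 'a \<Rightarrow> 'a \<Rightarrow> real" where
  "lazy_measure E p x y =
     (if y = x then p else if (x, y) \<in> E then (1 - p) / real (degree E x) else 0)"

definition coupling :: "'a set \<Rightarrow> ('a \<Rightarrow> real) \<Rightarrow> ('a \<Rightarrow> real) \<Rightarrow> ('a \<times> 'a \<Rightarrow> real) \<Rightarrow> bool" where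
  "coupling V \<mu> \<nu> \<pi> \<longleftrightarrow>
     (\<forall>z \<in> V \<times> V. \<pi> z \<in> {0..1}) \<and>
     (\<forall>x\<in>V. ((\<lambda>y. \<pi> (x, y)) has_sum \<mu> x) V) \<and>
     (\<forall>y\<in>V. ((\<lambda>x. \<pi> (x, y)) has_sum \<nu> y) V)"

text \<open>
  Couplings of infinite cost are left out, which does not affect the infimum. For finitely
  supported \<open>\<mu>\<close> and \<open>\<nu>\<close>, such as the measures \<^const>\<open>lazy_measure\<close>, every cost is finite.
\<close>

definition wasserstein :: "'a set \<Rightarrow> 'a rel \<Rightarrow> ('a \<Rightarrow> real) \<Rightarrow> ('a \<Rightarrow> real) \<Rightarrow> real" where
  "wasserstein V E \<mu> \<nu> =
     Inf {c. \<exists>\<pi>. coupling V \<mu> \<nu> \<pi> \<and>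
            ((\<lambda>(x, y). real (graph_dist E x y) * \<pi> (x, y)) has_sum c) (V \<times> V)}"

definition curvature :: "'a set \<Rightarrow> 'a rel \<Rightarrow> real \<Rightarrow> 'a \<Rightarrow> 'a \<Rightarrow> real" where
  "curvature V E p x y =
     1 - wasserstein V E (lazy_measure E p x) (lazy_measure E p y) / real (graph_dist E x y)"

text \<open>The idleness \<open>p\<close> lies in \<open>[0, 1]\<close>, so the limit is from the left.\<close>

definition curvature_LLY :: "'a set \<Rightarrow> 'a rel \<Rightarrow> 'a \<Rightarrow> 'a \<Rightarrow> real" where
  "curvature_LLY V E x y = Lim (at_left 1) (\<lambda>p. curvature V E p x y / (1 - p))"

text \<open>
  On a connected non-complete graph the set below is nonempty, and it is bounded below by \<open>-1\<close>:
  moving each of the two measures to its centre costs \<open>1 - p\<close>. So the real infimum is the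
  intended one.
\<close>

definition curvature_LLY2 :: "'a set \<Rightarrow> 'a rel \<Rightarrow> real" where
  "curvature_LLY2 V E = Inf {curvature_LLY V E x y | x y. x \<in> V \<and> y \<in> V \<and> graph_dist E x y = 2}"

end

theory Submission
  imports Defs
begin

text \<open>
  Let \<open>S\<close> be a minimum cut and split \<open>V - S\<close> into \<open>X\<close> and \<open>Y\<close> with no edges between them. The function
  that is \<open>1\<close> on \<open>X\<close>, \<open>0\<close> on \<open>S\<close> and \<open>-1\<close> on \<open>Y\<close> is 1-Lipschitz. By minimality a vertex of \<open>S\<close> has
  neighbours \<open>x \<in> X\<close> and \<open>y \<in> Y\<close>, which are at distance 2. The trivial direction of Kantorovich
  duality then gives
  \<open>2 \<kappa>(x, y) \<le> |N(x) \<inter> S| / deg x + |N(y) \<inter> S| / deg y \<le> (|N(x) \<inter> S| + |N(y) \<inter> S|) / \<delta>\<close>,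
  and by inclusion-exclusion the last numerator is at most \<open>|S| + \<beta>\<close>.
\<close>

subsection \<open>Transport costs\<close>

definition transport_cost :: "'a set \<Rightarrow> 'a rel \<Rightarrow> ('a \<Rightarrow> real) \<Rightarrow> ('a \<Rightarrow> real) \<Rightarrow> real \<Rightarrow> bool" where
  "transport_cost V E \<mu> \<nu> c \<longleftrightarrow> (\<exists>\<pi>. coupling V \<mu> \<nu> \<pi> \<and>
     ((\<lambda>(x, y). real (graph_dist E x y) * \<pi> (x, y)) has_sum c) (V \<times> V))"

lemma wasserstein_eq_Inf: "wasserstein V E \<mu> \<nu> = Inf {c. transport_cost V E \<mu> \<nu> c}"
  by (simp add: wasserstein_def transport_cost_def)

lemma transport_cost_nonneg:
  assumes "transport_cost V E \<mu> \<nu> c"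
  shows "0 \<le> c"
proof -
  obtain \<pi> where \<pi>: "coupling V \<mu> \<nu> \<pi>"
    "((\<lambda>(x, y). real (graph_dist E x y) * \<pi> (x, y)) has_sum c) (V \<times> V)"
    using assms by (auto simp: transport_cost_def)
  show ?thesis
    by (rule has_sum_nonneg[OF \<pi>(2)]) (use \<pi>(1) in \<open>auto simp: coupling_def\<close>)
qed

lemma wasserstein_le:
  assumes "transport_cost V E \<mu> \<nu> c"
  shows "wasserstein V E \<mu> \<nu> \<le> c"
  unfolding wasserstein_eq_Inf
  by (rule cInf_lower) (use assms in \<open>auto intro: bdd_belowI[of _ 0] transport_cost_nonneg\<close>)

text \<open>The witness \<open>c0\<close> makes the set of costs nonempty. The real
  \<open>Inf\<close> is a greatest lower bound only for nonempty sets.\<close>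

lemma wasserstein_ge:
  assumes "transport_cost V E \<mu> \<nu> c0" "\<And>c. transport_cost V E \<mu> \<nu> c \<Longrightarrow> b \<le> c"
  shows "b \<le> wasserstein V E \<mu> \<nu>"
  unfolding wasserstein_eq_Inf by (rule cInf_greatest) (use assms in auto)

text \<open>Marginals and cost are linear in the coupling, so a convex combination of two couplings
  witnesses the mixed cost.\<close>

lemma transport_cost_mix:
  assumes "transport_cost V E \<mu> \<nu> c" "transport_cost V E \<mu>' \<nu>' c'" "0 \<le> t" "t \<le> 1"
  shows "transport_cost V E (\<lambda>x. t * \<mu> x + (1 - t) * \<mu>' x) (\<lambda>x. t * \<nu> x + (1 - t) * \<nu>' x)
    (t * c + (1 - t) * c')"
proof -
  obtain \<pi> where \<pi>: "coupling V \<mu> \<nu> \<pi>"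
    "((\<lambda>(x, y). real (graph_dist E x y) * \<pi> (x, y)) has_sum c) (V \<times> V)"
    using assms(1) by (auto simp: transport_cost_def)
  obtain \<pi>' where \<pi>': "coupling V \<mu>' \<nu>' \<pi>'"
    "((\<lambda>(x, y). real (graph_dist E x y) * \<pi>' (x, y)) has_sum c') (V \<times> V)"
    using assms(2) by (auto simp: transport_cost_def)
  define \<rho> where "\<rho> z = t * \<pi> z + (1 - t) * \<pi>' z" for z
  have "coupling V (\<lambda>x. t * \<mu> x + (1 - t) * \<mu>' x) (\<lambda>x. t * \<nu> x + (1 - t) * \<nu>' x) \<rho>"
    unfolding coupling_def
  proof (intro conjI ballI)
    fix z assume z: "z \<in> V \<times> V"
    have "\<pi> z \<in> {0..1}" "\<pi>' z \<in> {0..1}"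
      using \<pi>(1) \<pi>'(1) z by (auto simp: coupling_def)
    then show "\<rho> z \<in> {0..1}"
      using assms(3,4) convex_bound_le[of "\<pi> z" 1 "\<pi>' z" t "1 - t"] by (auto simp: \<rho>_def)
  next
    fix x assume "x \<in> V"
    then show "((\<lambda>y. \<rho> (x, y)) has_sum t * \<mu> x + (1 - t) * \<mu>' x) V"
      unfolding \<rho>_def using \<pi>(1) \<pi>'(1)
      by (auto simp: coupling_def intro!: has_sum_add has_sum_cmult_right)
  next
    fix y assume "y \<in> V"
    then show "((\<lambda>x. \<rho> (x, y)) has_sum t * \<nu> y + (1 - t) * \<nu>' y) V"
      unfolding \<rho>_def using \<pi>(1) \<pi>'(1)
      by (auto simp: coupling_def intro!: has_sum_add has_sum_cmult_right)
  qed
  moreover have "((\<lambda>(x, y). real (graph_dist E x y) * \<rho> (x, y)) has_sum t * c + (1 - t) * c') (V \<times> V)"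
    using has_sum_add[OF has_sum_cmult_right[OF \<pi>(2), of t] has_sum_cmult_right[OF \<pi>'(2), of "1 - t"]]
    by (rule has_sum_cong[THEN iffD1, rotated]) (auto simp: \<rho>_def algebra_simps)
  ultimately show ?thesis
    unfolding transport_cost_def by blast
qed

text \<open>The independent coupling witnesses this. It is rarely optimal, but it shows that a
  finite cost exists and gives explicit upper bounds.\<close>

lemma transport_cost_product:
  assumes A: "finite A" "A \<subseteq> V" "\<And>x. x \<notin> A \<Longrightarrow> \<mu> x = 0" "\<And>x. 0 \<le> \<mu> x" "sum \<mu> A = 1"
    and B: "finite B" "B \<subseteq> V" "\<And>x. x \<notin> B \<Longrightarrow> \<nu> x = 0" "\<And>x. 0 \<le> \<nu> x" "sum \<nu> B = 1"
  shows "transport_cost V E \<mu> \<nu> (\<Sum>(x, y)\<in>A \<times> B. real (graph_dist E x y) * (\<mu> x * \<nu> y))"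
proof -
  have le1: "\<mu> x \<le> 1" for x
    using A member_le_sum[of x A \<mu>] by (cases "x \<in> A") auto
  have le1': "\<nu> x \<le> 1" for x
    using B member_le_sum[of x B \<nu>] by (cases "x \<in> B") auto
  have supp: "x \<in> A" if "\<mu> x \<noteq> 0" for x
    using A(3) that by blast
  have supp': "y \<in> B" if "\<nu> y \<noteq> 0" for y
    using B(3) that by blast
  have "coupling V \<mu> \<nu> (\<lambda>(x, y). \<mu> x * \<nu> y)"
    unfolding coupling_def
  proof (intro conjI ballI)
    fix z assume "z \<in> V \<times> V"
    then show "(case z of (x, y) \<Rightarrow> \<mu> x * \<nu> y) \<in> {0..1}"
      using le1 le1' A(4) B(4) by (auto intro: mult_le_one)
  next
    fix x
    show "((\<lambda>y. case (x, y) of (x, y) \<Rightarrow> \<mu> x * \<nu> y) has_sum \<mu> x) V"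
      by (rule has_sum_finite_neutralI[of B]) (use B in \<open>auto simp flip: sum_distrib_left\<close>)
  next
    fix y
    show "((\<lambda>x. case (x, y) of (x, y) \<Rightarrow> \<mu> x * \<nu> y) has_sum \<nu> y) V"
      by (rule has_sum_finite_neutralI[of A]) (use A in \<open>auto simp flip: sum_distrib_right\<close>)
  qed
  moreover have "((\<lambda>(x, y). real (graph_dist E x y) * (case (x, y) of (x, y) \<Rightarrow> \<mu> x * \<nu> y)) has_sum
      (\<Sum>(x, y)\<in>A \<times> B. real (graph_dist E x y) * (\<mu> x * \<nu> y))) (V \<times> V)"
    by (rule has_sum_finite_neutralI[of "A \<times> B"]) (use A(1,2) B(1,2) supp supp' in auto)
  ultimately show ?thesis
    unfolding transport_cost_def by blast
qed

text \<open>Weak Kantorovich duality: integrating \<open>f u - f v\<close> against any coupling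
  gives the difference of the two expectations, and the integrand is at most the distance.\<close>

lemma Lipschitz_le_transport_cost:
  assumes cost: "transport_cost V E \<mu> \<nu> c"
    and A: "finite A" "A \<subseteq> V" "\<And>x. x \<notin> A \<Longrightarrow> \<mu> x = 0"
    and B: "finite B" "B \<subseteq> V" "\<And>x. x \<notin> B \<Longrightarrow> \<nu> x = 0"
    and f: "\<And>u v. u \<in> V \<Longrightarrow> v \<in> V \<Longrightarrow> f u - f v \<le> real (graph_dist E u v)"
  shows "(\<Sum>x\<in>A. \<mu> x * f x) - (\<Sum>y\<in>B. \<nu> y * f y) \<le> c"
proof -
  obtain \<pi> where \<pi>: "coupling V \<mu> \<nu> \<pi>"
    "((\<lambda>(x, y). real (graph_dist E x y) * \<pi> (x, y)) has_sum c) (V \<times> V)"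
    using cost by (auto simp: transport_cost_def)
  have nonneg: "0 \<le> \<pi> (x, y)" if "x \<in> V" "y \<in> V" for x y
    using \<pi>(1) that by (auto simp: coupling_def)
  have row: "((\<lambda>y. \<pi> (x, y)) has_sum \<mu> x) V" if "x \<in> V" for x
    using \<pi>(1) that by (auto simp: coupling_def)
  have col: "((\<lambda>x. \<pi> (x, y)) has_sum \<nu> y) V" if "y \<in> V" for y
    using \<pi>(1) that by (auto simp: coupling_def)
  \<comment> \<open>A single entry is at most its marginal, which vanishes off the support. So the
    coupling lives on the finite set \<open>A \<times> B\<close> and the marginals become finite
    sums.\<close>
  have "\<pi> (x, y) \<le> \<mu> x" if "x \<in> V" "y \<in> V" for x y
    using finite_sum_le_has_sum[OF row[OF that(1)], of "{y}"] that nonneg by auto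
  then have zero1: "\<pi> (x, y) = 0" if "x \<in> V" "y \<in> V" "x \<notin> A" for x y
    using that nonneg A(3) by (metis order_antisym)
  have "\<pi> (x, y) \<le> \<nu> y" if "x \<in> V" "y \<in> V" for x y
    using finite_sum_le_has_sum[OF col[OF that(2)], of "{x}"] that nonneg by auto
  then have zero2: "\<pi> (x, y) = 0" if "x \<in> V" "y \<in> V" "y \<notin> B" for x y
    using that nonneg B(3) by (metis order_antisym)
  have \<mu>: "\<mu> x = (\<Sum>y\<in>B. \<pi> (x, y))" if "x \<in> A" for x
  proof (rule has_sum_unique[OF row])
    show "((\<lambda>y. \<pi> (x, y)) has_sum (\<Sum>y\<in>B. \<pi> (x, y))) V"
      by (rule has_sum_finite_neutralI[of B]) (use B A(2) zero2 that in auto)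
  qed (use A(2) that in auto)
  have \<nu>: "\<nu> y = (\<Sum>x\<in>A. \<pi> (x, y))" if "y \<in> B" for y
  proof (rule has_sum_unique[OF col])
    show "((\<lambda>x. \<pi> (x, y)) has_sum (\<Sum>x\<in>A. \<pi> (x, y))) V"
      by (rule has_sum_finite_neutralI[of A]) (use A B(2) zero1 that in auto)
  qed (use B(2) that in auto)
  have "(\<Sum>x\<in>A. \<mu> x * f x) - (\<Sum>y\<in>B. \<nu> y * f y)
      = (\<Sum>x\<in>A. \<Sum>y\<in>B. \<pi> (x, y) * f x) - (\<Sum>y\<in>B. \<Sum>x\<in>A. \<pi> (x, y) * f y)"
    by (simp add: \<mu> \<nu> sum_distrib_right)
  also have "\<dots> = (\<Sum>x\<in>A. \<Sum>y\<in>B. \<pi> (x, y) * f x) - (\<Sum>x\<in>A. \<Sum>y\<in>B. \<pi> (x, y) * f y)"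
    by (simp add: sum.swap[of _ A B])
  also have "\<dots> = (\<Sum>x\<in>A. \<Sum>y\<in>B. (f x - f y) * \<pi> (x, y))"
    by (simp add: sum_subtractf algebra_simps)
  also have "\<dots> \<le> (\<Sum>x\<in>A. \<Sum>y\<in>B. real (graph_dist E x y) * \<pi> (x, y))"
    using A(2) B(2) f nonneg by (intro sum_mono mult_right_mono) (auto simp: subset_iff)
  also have "\<dots> = (\<Sum>(x, y)\<in>A \<times> B. real (graph_dist E x y) * \<pi> (x, y))"
    by (simp add: sum.cartesian_product)
  also have "\<dots> \<le> c"
    by (rule finite_sum_le_has_sum[OF \<pi>(2)]) (use A B nonneg in auto)
  finally show ?thesis .
qed

subsection \<open>Graph distance\<close>

lemma graph_dist_le: "(x, y) \<in> E ^^ n \<Longrightarrow> graph_dist E x y \<le> n"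
  unfolding graph_dist_def by (rule Least_le)

lemma graph_dist_relpow: "(x, y) \<in> E\<^sup>* \<Longrightarrow> (x, y) \<in> E ^^ graph_dist E x y"
  unfolding graph_dist_def by (metis LeastI_ex rtrancl_imp_relpow)

lemma graph_dist_self [simp]: "graph_dist E x x = 0"
  using graph_dist_le[where n = 0] by fastforce

lemma relpow_2_iff: "(x, y) \<in> E ^^ 2 \<longleftrightarrow> (\<exists>s. (x, s) \<in> E \<and> (s, y) \<in> E)"
  by (auto simp: numeral_2_eq_2)

lemma graph_dist_eq_2I:
  assumes "(x, s) \<in> E" "(s, y) \<in> E" "(x, y) \<notin> E" "x \<noteq> y"
  shows "graph_dist E x y = 2"
proof -
  have xy: "(x, y) \<in> E ^^ 2"
    using assms(1,2) by (auto simp: relpow_2_iff)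
  then have "(x, y) \<in> E ^^ graph_dist E x y"
    by (intro graph_dist_relpow relpow_imp_rtrancl)
  then have "graph_dist E x y \<noteq> 0" "graph_dist E x y \<noteq> 1"
    using assms(3,4) by (metis relpow_0_E, metis relpow_1)
  with graph_dist_le[OF xy] show ?thesis
    by linarith
qed

text \<open>The increments of \<open>f\<close> telescope along a shortest path, so the bound need
  only be checked on edges.\<close>

lemma Lipschitz_graph_dist:
  fixes f :: "'a \<Rightarrow> real"
  assumes "\<And>u v. (u, v) \<in> E \<Longrightarrow> f u - f v \<le> 1" "(u, v) \<in> E\<^sup>*"
  shows "f u - f v \<le> real (graph_dist E u v)"
proof -
  have "f u - f v \<le> real n" if "(u, v) \<in> E ^^ n" for n v
    using that
  proof (induction n arbitrary: v)
    case (Suc n)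
    then obtain w where "(u, w) \<in> E ^^ n" "(w, v) \<in> E"
      by auto
    then show ?case
      using Suc.IH[of w] assms(1)[of w v] by simp
  qed auto
  then show ?thesis
    using graph_dist_relpow[OF assms(2)] by blast
qed

subsection \<open>Curvature\<close>

context locally_finite_graph
begin

section \<open>Lazy measures: expectations, total mass and couplings\<close>

lemma lazy_measure_expectation:
  assumes "x \<in> V"
  shows "(\<Sum>y\<in>insert x (E `` {x}). lazy_measure E p x y * f y)
    = p * f x + (1 - p) / real (degree E x) * (\<Sum>y\<in>E `` {x}. f y)"
proof -
  have "x \<notin> E `` {x}"
    using edges_irrefl by (auto simp: irrefl_def)
  moreover have "(\<Sum>y\<in>E `` {x}. lazy_measure E p x y * f y)
      = (\<Sum>y\<in>E `` {x}. (1 - p) / real (degree E x) * f y)"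
    using \<open>x \<notin> E `` {x}\<close> by (intro sum.cong) (auto simp: lazy_measure_def)
  ultimately show ?thesis
    using locally_finite[OF assms] by (simp add: lazy_measure_def[of E p x x] sum_distrib_left)
qed

lemma degree_pos: "x \<in> V \<Longrightarrow> (x, s) \<in> E \<Longrightarrow> 0 < degree E x"
  using locally_finite by (auto simp: degree_def card_gt_0_iff)

lemma sum_lazy_measure:
  assumes "x \<in> V" "0 < degree E x"
  shows "(\<Sum>y\<in>insert x (E `` {x}). lazy_measure E p x y) = 1"
  using lazy_measure_expectation[OF assms(1), of p "\<lambda>_. 1"] assms(2)
  by (simp add: degree_def)

lemma lazy_measure_support:
  assumes "x \<in> V"
  shows "finite (insert x (E `` {x}))" "insert x (E `` {x}) \<subseteq> V"
    "\<And>y. y \<notin> insert x (E `` {x}) \<Longrightarrow> lazy_measure E p x y = 0"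
  using assms locally_finite[OF assms] edges_subset by (auto simp: lazy_measure_def)

lemma lazy_measure_nonneg: "0 \<le> p \<Longrightarrow> p \<le> 1 \<Longrightarrow> 0 \<le> lazy_measure E p x y"
  by (simp add: lazy_measure_def)

lemma lazy_measure_1: "lazy_measure E 1 x y = (if y = x then 1 else 0)"
  by (simp add: lazy_measure_def)

text \<open>The measure is affine in its idleness, and idleness 1 gives the Dirac measure at
  \<open>x\<close>. Raising the idleness is thus mixing with a Dirac measure.\<close>

lemma lazy_measure_mix:
  "lazy_measure E (t * p + (1 - t)) x = (\<lambda>y. t * lazy_measure E p x y + (1 - t) * lazy_measure E 1 x y)"
  by (auto simp: lazy_measure_def fun_eq_iff algebra_simps diff_divide_distrib)

lemma transport_cost_lazy_measure:
  assumes "x \<in> V" "0 < degree E x" "y \<in> V" "0 < degree E y" "0 \<le> p" "p \<le> 1"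
  shows "transport_cost V E (lazy_measure E p x) (lazy_measure E p y)
    (\<Sum>(u, v)\<in>insert x (E `` {x}) \<times> insert y (E `` {y}).
       real (graph_dist E u v) * (lazy_measure E p x u * lazy_measure E p y v))"
  using assms sum_lazy_measure
  by (intro transport_cost_product lazy_measure_support lazy_measure_nonneg) auto

lemma transport_cost_Dirac:
  assumes "x \<in> V" "0 < degree E x" "y \<in> V" "0 < degree E y"
  shows "transport_cost V E (lazy_measure E 1 x) (lazy_measure E 1 y) (real (graph_dist E x y))"
proof -
  \<comment> \<open>The product of two Dirac measures has the single atom
    \<open>(x, y)\<close>.\<close>
  have "(\<Sum>(u, v)\<in>insert x (E `` {x}) \<times> insert y (E `` {y}).
       real (graph_dist E u v) * (lazy_measure E 1 x u * lazy_measure E 1 y v))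
     = (\<Sum>(u, v)\<in>{(x, y)}. real (graph_dist E u v) * (lazy_measure E 1 x u * lazy_measure E 1 y v))"
    using assms locally_finite
    by (intro sum.mono_neutral_right) (auto simp: lazy_measure_1 split: if_splits)
  with transport_cost_lazy_measure[OF assms, of 1] show ?thesis
    by (simp add: lazy_measure_1)
qed

text \<open>Mixing with the Dirac measures is convexity of the Wasserstein distance on chords ending at
  idleness 1.\<close>

lemma curvature_ratio_mono:
  assumes "x \<in> V" "0 < degree E x" "y \<in> V" "0 < degree E y" "0 < graph_dist E x y"
    and "0 \<le> p" "p \<le> q" "q < 1"
  shows "curvature V E p x y / (1 - p) \<le> curvature V E q x y / (1 - q)"
proof -
  \<comment> \<open>The weight that places \<open>q\<close> on the segment from \<open>p\<close> to
    1.\<close>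
  define t where "t = (1 - q) / (1 - p)"
  define d where "d = real (graph_dist E x y)"
  let ?W = "\<lambda>p. wasserstein V E (lazy_measure E p x) (lazy_measure E p y)"
  have t: "0 < t" "t \<le> 1" and d: "0 < d"
    using assms by (auto simp: t_def d_def)
  have q: "q = t * p + (1 - t)"
  proof -
    have "t * (1 - p) = 1 - q"
      using assms by (simp add: t_def)
    then show ?thesis
      by (simp add: algebra_simps)
  qed
  \<comment> \<open>Convexity solved for \<open>?W p\<close>, so that it can be checked on each cost
    \<open>c\<close> at idleness \<open>p\<close>: mixing turns \<open>c\<close> into the cost
    \<open>t * c + (1 - t) * d\<close> at idleness \<open>q\<close>.\<close>
  have "(?W q - (1 - t) * d) / t \<le> ?W p"
  proof (rule wasserstein_ge[OF transport_cost_lazy_measure])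
    fix c assume "transport_cost V E (lazy_measure E p x) (lazy_measure E p y) c"
    then have "transport_cost V E (lazy_measure E q x) (lazy_measure E q y) (t * c + (1 - t) * d)"
      unfolding q lazy_measure_mix d_def
      using transport_cost_mix transport_cost_Dirac[OF assms(1-4)] t by fastforce
    then show "(?W q - (1 - t) * d) / t \<le> c"
      using wasserstein_le t by (fastforce simp: field_simps)
  qed (use assms in auto)
  then have "?W q \<le> t * ?W p + (1 - t) * d"
    using t by (simp add: field_simps)
  then have "?W q / d \<le> (t * ?W p + (1 - t) * d) / d"
    using d by (intro divide_right_mono) auto
  then have "t * (1 - ?W p / d) \<le> 1 - ?W q / d"
    using d by (simp add: add_divide_distrib right_diff_distrib)
  then have "t * curvature V E p x y \<le> curvature V E q x y"
    by (simp add: curvature_def d_def)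
  then show ?thesis
    using assms by (simp add: t_def field_simps)
qed

text \<open>The ratio increases with \<open>p\<close> and is bounded by \<open>K\<close>, so it
  converges to its supremum. This gives \<open>Lim\<close> its intended value, which lies between
  the ratio at 0 and \<open>K\<close>.\<close>

lemma curvature_LLY_bounds:
  assumes "x \<in> V" "0 < degree E x" "y \<in> V" "0 < degree E y" "0 < graph_dist E x y"
    and bound: "\<And>p. 0 \<le> p \<Longrightarrow> p < 1 \<Longrightarrow> curvature V E p x y / (1 - p) \<le> K"
  shows "curvature V E 0 x y \<le> curvature_LLY V E x y" "curvature_LLY V E x y \<le> K"
proof -
  define g where "g p = curvature V E p x y / (1 - p)" for p
  define L where "L = Sup (g ` ({..<1} \<inter> {0..}))"
  have "(g \<longlongrightarrow> L) (at 1 within ({..<1} \<inter> {0..}))"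
    unfolding L_def
    by (rule Lim_left_bound[where K = K])
       (use bound curvature_ratio_mono[OF assms(1-5)] in \<open>auto simp: g_def\<close>)
  \<comment> \<open>Monotonicity holds for nonnegative idleness only. Restricting to it does not
    change the left neighbourhoods of 1.\<close>
  also have "at 1 within ({..<1} \<inter> {0..}) = at_left (1::real)"
    by (rule at_within_nhd[where S = "{0<..}"]) auto
  finally have lim: "(g \<longlongrightarrow> L) (at_left 1)" .
  then have L: "curvature_LLY V E x y = L"
    unfolding curvature_LLY_def g_def by (intro tendsto_Lim) auto
  have ev: "eventually (\<lambda>p. p \<in> {0<..<1}) (at_left (1::real))"
    by (rule eventually_at_leftI[of 0]) auto
  have "eventually (\<lambda>p. g 0 \<le> g p) (at_left 1)"
    using ev by eventually_elim (use curvature_ratio_mono[OF assms(1-5), of 0] in \<open>auto simp: g_def\<close>)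
  then have "g 0 \<le> L"
    using lim by (intro tendsto_lowerbound) auto
  then show "curvature V E 0 x y \<le> curvature_LLY V E x y"
    by (simp add: L g_def)
  have "eventually (\<lambda>p. g p \<le> K) (at_left 1)"
    using ev by eventually_elim (use bound in \<open>auto simp: g_def\<close>)
  then show "curvature_LLY V E x y \<le> K"
    unfolding L using lim by (intro tendsto_upperbound) auto
qed

text \<open>Duality with a test function that attains the distance between \<open>x\<close> and
  \<open>y\<close>. The idle mass then contributes exactly \<open>p * d\<close>, so a factor
  \<open>1 - p\<close> splits off and the bound on the ratio is independent of
  \<open>p\<close>.\<close>

lemma curvature_ratio_le:
  assumes "connected_graph V E" "x \<in> V" "0 < degree E x" "y \<in> V" "0 < degree E y"
    and f: "\<And>u v. (u, v) \<in> E \<Longrightarrow> f u - f v \<le> 1" "f x - f y = real (graph_dist E x y)"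
    and p: "0 \<le> p" "p < 1" and d: "0 < graph_dist E x y"
  shows "curvature V E p x y / (1 - p)
    \<le> 1 - ((\<Sum>u\<in>E `` {x}. f u) / real (degree E x) - (\<Sum>v\<in>E `` {y}. f v) / real (degree E y))
          / real (graph_dist E x y)"
proof -
  define d where "d = real (graph_dist E x y)"
  define D where "D = (\<Sum>u\<in>E `` {x}. f u) / real (degree E x) - (\<Sum>v\<in>E `` {y}. f v) / real (degree E y)"
  let ?W = "wasserstein V E (lazy_measure E p x) (lazy_measure E p y)"
  have "p * d + (1 - p) * D \<le> ?W"
  proof (rule wasserstein_ge[OF transport_cost_lazy_measure])
    fix c assume c: "transport_cost V E (lazy_measure E p x) (lazy_measure E p y) c"
    have "f u - f v \<le> real (graph_dist E u v)" if "u \<in> V" "v \<in> V" for u v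
      by (rule Lipschitz_graph_dist) (use assms(1) f(1) that in \<open>auto simp: connected_graph_def\<close>)
    then have "(\<Sum>u\<in>insert x (E `` {x}). lazy_measure E p x u * f u)
        - (\<Sum>v\<in>insert y (E `` {y}). lazy_measure E p y v * f v) \<le> c"
      using assms(2,4) by (intro Lipschitz_le_transport_cost[OF c] lazy_measure_support) auto
    then have "(p * f x + (1 - p) / real (degree E x) * (\<Sum>u\<in>E `` {x}. f u))
        - (p * f y + (1 - p) / real (degree E y) * (\<Sum>v\<in>E `` {y}. f v)) \<le> c"
      by (simp only: lazy_measure_expectation[OF \<open>x \<in> V\<close>] lazy_measure_expectation[OF \<open>y \<in> V\<close>])
    moreover have "p * d = p * f x - p * f y"
      by (simp add: d_def flip: f(2) right_diff_distrib)
    ultimately show "p * d + (1 - p) * D \<le> c"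
      by (simp add: D_def right_diff_distrib)
  qed (use assms in auto)
  then have "(p * d + (1 - p) * D) / d \<le> ?W / d"
    by (intro divide_right_mono) (auto simp: d_def)
  then have "1 - ?W / d \<le> (1 - p) * (1 - D / d)"
    using d by (simp add: d_def add_divide_distrib right_diff_distrib)
  then show ?thesis
    using p by (simp add: curvature_def d_def D_def field_simps)
qed

text \<open>At idleness 0 all mass sits on neighbours of \<open>x\<close> and of \<open>y\<close>,
  which are at most 1 + 2 + 1 = 4 apart. Hence the transport costs at most 4, and 1 - 4/2 =
  -1.\<close>

lemma curvature_0_ge_minus_1:
  assumes "x \<in> V" "y \<in> V" "graph_dist E x y = 2" "(x, y) \<in> E\<^sup>*"
  shows "- 1 \<le> curvature V E 0 x y"
proof -
  have xy: "(x, y) \<in> E ^^ 2"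
    using graph_dist_relpow[OF assms(4)] assms(3) by simp
  then obtain s where s: "(x, s) \<in> E" "(s, y) \<in> E"
    by (auto simp: relpow_2_iff)
  have deg: "0 < degree E x" "0 < degree E y"
    using degree_pos[OF assms(1) s(1)] degree_pos[OF assms(2), of s] s(2) edges_sym
    by (auto dest: symD)
  let ?A = "insert x (E `` {x})" and ?B = "insert y (E `` {y})"
  let ?\<mu> = "lazy_measure E 0 x" and ?\<nu> = "lazy_measure E 0 y"
  have "wasserstein V E ?\<mu> ?\<nu> \<le> (\<Sum>(u, v)\<in>?A \<times> ?B. real (graph_dist E u v) * (?\<mu> u * ?\<nu> v))"
    using assms deg by (intro wasserstein_le transport_cost_lazy_measure) auto
  also have "\<dots> \<le> (\<Sum>(u, v)\<in>?A \<times> ?B. 4 * (?\<mu> u * ?\<nu> v))"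
  proof (intro sum_mono, clarify)
    fix u v
    have nonneg: "0 \<le> ?\<mu> u * ?\<nu> v"
      by (simp add: lazy_measure_nonneg)
    show "real (graph_dist E u v) * (?\<mu> u * ?\<nu> v) \<le> 4 * (?\<mu> u * ?\<nu> v)"
    \<comment> \<open>Otherwise one factor of the product measure vanishes and both sides are 0;
      this includes \<open>u = x\<close> and \<open>v = y\<close>.\<close>
    proof (cases "(x, u) \<in> E \<and> (y, v) \<in> E")
      case True
      then have "(u, x) \<in> E ^^ 1" "(y, v) \<in> E ^^ 1"
        using edges_sym by (auto dest: symD)
      then have "(u, v) \<in> E ^^ (1 + 2 + 1)"
        using xy unfolding relpow_add by blast
      then have "graph_dist E u v \<le> 4"
        using graph_dist_le by fastforce
      then show ?thesis
        using nonneg by (intro mult_right_mono) auto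
    qed (auto simp: lazy_measure_def)
  qed
  also have "\<dots> = 4 * (sum ?\<mu> ?A * sum ?\<nu> ?B)"
    unfolding sum_product sum.cartesian_product by (simp only: sum_distrib_left case_prod_unfold)
  also have "\<dots> = 4"
    using sum_lazy_measure[OF assms(1) deg(1)] sum_lazy_measure[OF assms(2) deg(2)] by simp
  finally show ?thesis
    by (simp add: curvature_def assms(3))
qed

text \<open>The upper bound obtained from the distance to \<open>y\<close> only serves to make the limit exist.\<close>

lemma curvature_LLY_ge_minus_1:
  assumes "connected_graph V E" "x \<in> V" "y \<in> V" "graph_dist E x y = 2"
  shows "- 1 \<le> curvature_LLY V E x y"
proof -
  have reach: "(u, v) \<in> E\<^sup>*" if "u \<in> V" "v \<in> V" for u v
    using assms(1) that by (auto simp: connected_graph_def)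
  have "(x, y) \<in> E ^^ 2"
    using graph_dist_relpow[OF reach[OF assms(2,3)]] assms(4) by simp
  then obtain s where s: "(x, s) \<in> E" "(s, y) \<in> E"
    by (auto simp: relpow_2_iff)
  have deg: "0 < degree E x" "0 < degree E y"
    using degree_pos[OF assms(2) s(1)] degree_pos[OF assms(3), of s] s(2) edges_sym
    by (auto dest: symD)
  have "real (graph_dist E u y) - real (graph_dist E v y) \<le> 1" if uv: "(u, v) \<in> E" for u v
  proof -
    have "(v, y) \<in> E ^^ graph_dist E v y"
      using uv edges_subset assms(3) by (intro graph_dist_relpow reach) auto
    then have "(u, y) \<in> E ^^ Suc (graph_dist E v y)"
      using uv by (intro relpow_Suc_I2)
    then show ?thesis
      using graph_dist_le by fastforce
  qed
  from curvature_ratio_le[OF assms(1,2) deg(1) assms(3) deg(2), of "\<lambda>u. real (graph_dist E u y)", OF this]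
  have "curvature V E 0 x y \<le> curvature_LLY V E x y"
    using assms deg by (intro curvature_LLY_bounds) auto
  then show ?thesis
    using curvature_0_ge_minus_1[OF assms(2-4) reach[OF assms(2,3)]] by simp
qed

text \<open>The bound -1 makes the set bounded below, so its real \<open>Inf\<close> is indeed a
  lower bound.\<close>

lemma curvature_LLY2_le:
  assumes "connected_graph V E" "x \<in> V" "y \<in> V" "graph_dist E x y = 2"
  shows "curvature_LLY2 V E \<le> curvature_LLY V E x y"
  unfolding curvature_LLY2_def
  by (rule cInf_lower) (use assms curvature_LLY_ge_minus_1 in \<open>auto intro!: bdd_belowI[of _ "- 1"]\<close>)

lemma curvature_LLY_le_cut:
  assumes "connected_graph V E"
    and X: "X \<inter> S = {}" "E `` X \<subseteq> X \<union> S" "x \<in> X" "y \<in> V - S - X" "x \<in> V"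
    and s: "(x, s) \<in> E" "(s, y) \<in> E"
  shows "curvature_LLY V E x y \<le> (real (card (E `` {x} \<inter> S)) / real (degree E x)
    + real (card (E `` {y} \<inter> S)) / real (degree E y)) / 2"
proof -
  define f :: "'a \<Rightarrow> real" where "f u = (if u \<in> X then 1 else if u \<in> S then 0 else - 1)" for u
  have y: "y \<in> V"
    using X by auto
  have deg: "0 < degree E x" "0 < degree E y"
    using degree_pos[OF \<open>x \<in> V\<close> s(1)] degree_pos[OF y, of s] s(2) edges_sym by (auto dest: symD)
  have "(x, y) \<notin> E" "x \<noteq> y"
    using X by auto
  then have dist: "graph_dist E x y = 2"
    using s by (intro graph_dist_eq_2I)
  \<comment> \<open>The increment exceeds 1 only from \<open>X\<close> to a vertex outside
    \<open>X \<union> S\<close>, and no edge does that.\<close>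
  have f_Lip: "f u - f v \<le> 1" if "(u, v) \<in> E" for u v
    using that X(2) by (auto simp: f_def)
  have f_dist: "f x - f y = real (graph_dist E x y)"
    using X by (auto simp: f_def dist)
  have card_diff: "real (card (E `` {z} - S)) = real (degree E z) - real (card (E `` {z} \<inter> S))"
    if "z \<in> V" for z
  proof -
    have "card (E `` {z}) = card (E `` {z} - S) + card (E `` {z} \<inter> S)"
      using locally_finite[OF that] card_Un_disjoint[of "E `` {z} - S" "E `` {z} \<inter> S"]
      by (auto simp: Un_Diff_Int)
    then show ?thesis
      by (simp add: degree_def)
  qed
  \<comment> \<open>Neighbours in \<open>S\<close> contribute 0; the others lie in \<open>X\<close>,
    where \<open>f\<close> is 1.\<close>
  have "(\<Sum>u\<in>E `` {x}. f u) = (\<Sum>u\<in>E `` {x} - S. 1)"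
    using locally_finite[OF \<open>x \<in> V\<close>] X by (intro sum.mono_neutral_cong_right) (auto simp: f_def)
  then have sum_x: "(\<Sum>u\<in>E `` {x}. f u) = real (degree E x) - real (card (E `` {x} \<inter> S))"
    using card_diff[OF \<open>x \<in> V\<close>] by simp
  \<comment> \<open>By symmetry such an edge would leave \<open>X\<close> and end at
    \<open>y\<close>, outside \<open>X \<union> S\<close>. So \<open>f\<close> is -1 at every
    neighbour of \<open>y\<close> outside \<open>S\<close>.\<close>
  have "E `` {y} \<inter> X = {}"
    using X edges_sym by (auto dest: symD)
  then have "(\<Sum>v\<in>E `` {y}. f v) = (\<Sum>v\<in>E `` {y} - S. - 1)"
    using locally_finite[OF y] by (intro sum.mono_neutral_cong_right) (auto simp: f_def)
  then have sum_y: "(\<Sum>v\<in>E `` {y}. f v) = real (card (E `` {y} \<inter> S)) - real (degree E y)"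
    using card_diff[OF y] by simp
  have "curvature_LLY V E x y
    \<le> 1 - ((\<Sum>u\<in>E `` {x}. f u) / real (degree E x) - (\<Sum>v\<in>E `` {y}. f v) / real (degree E y))
          / real (graph_dist E x y)"
    using curvature_ratio_le[OF assms(1) \<open>x \<in> V\<close> deg(1) y deg(2) f_Lip f_dist] \<open>x \<in> V\<close> y deg dist
    by (intro curvature_LLY_bounds) auto
  also have "\<dots> = (real (card (E `` {x} \<inter> S)) / real (degree E x)
    + real (card (E `` {y} \<inter> S)) / real (degree E y)) / 2"
    using deg by (simp add: sum_x sum_y dist field_simps)
  finally show ?thesis .
qed

subsection \<open>Cuts\<close>

text \<open>Deleting its neighbourhood isolates \<open>x\<close>, while \<open>y\<close>
  survives.\<close>

lemma neighbours_disconnect: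
  assumes "x \<in> V" "y \<in> V" "x \<noteq> y" "(x, y) \<notin> E"
  shows "disconnects V E (E `` {x})"
proof -
  let ?F = "E \<inter> (V - E `` {x}) \<times> (V - E `` {x})"
  have "(x, y) \<notin> ?F\<^sup>*"
    using assms(3) by (auto elim: converse_rtranclE)
  moreover have "x \<in> V - E `` {x}" "y \<in> V - E `` {x}"
    using assms edges_irrefl by (auto simp: irrefl_def)
  ultimately show ?thesis
    using edges_subset by (auto simp: disconnects_def connected_graph_def)
qed

text \<open>A neighbourhood is a finite cut, so the \<open>LEAST\<close> in
  \<open>connectivity\<close> is attained. A finite cut of least cardinality is also minimal under
  inclusion.\<close>

lemma minimum_cut:
  assumes "\<not> complete_graph V E"
  obtains S where "finite S" "disconnects V E S" "card S = connectivity V E"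
    "\<And>T. T \<subset> S \<Longrightarrow> \<not> disconnects V E T"
proof -
  let ?P = "\<lambda>n. \<exists>S. finite S \<and> disconnects V E S \<and> card S = n"
  obtain x y where "x \<in> V" "y \<in> V" "x \<noteq> y" "(x, y) \<notin> E"
    using assms by (auto simp: complete_graph_def)
  then have "?P (card (E `` {x}))"
    using neighbours_disconnect locally_finite by blast
  then have "?P (connectivity V E)"
    unfolding connectivity_def by (rule LeastI)
  then obtain S where S: "finite S" "disconnects V E S" "card S = connectivity V E"
    by blast
  moreover have "\<not> disconnects V E T" if "T \<subset> S" for T
  proof
    assume "disconnects V E T"
    moreover have "finite T"
      using that S(1) finite_subset by blast
    ultimately have "connectivity V E \<le> card T"
      unfolding connectivity_def by (intro Least_le) blast
    with psubset_card_mono[OF S(1) that] S(3) show False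
      by simp
  qed
  ultimately show ?thesis
    using that by blast
qed

text \<open>Take \<open>X\<close> to be one component of the graph without \<open>S\<close>. Putting
  any \<open>s\<close> of \<open>S\<close> back restores connectedness by minimality, so
  \<open>s\<close> must have neighbours both in \<open>X\<close> and in the rest.\<close>

lemma minimal_cut_split:
  assumes "connected_graph V E" "disconnects V E S" "\<And>T. T \<subset> S \<Longrightarrow> \<not> disconnects V E T"
  obtains X x y s where "X \<subseteq> V - S" "E `` X \<subseteq> X \<union> S" "x \<in> X" "y \<in> V - S - X" "s \<in> S"
    "(x, s) \<in> E" "(s, y) \<in> E"
proof -
  define F where "F = E \<inter> (V - S) \<times> (V - S)"
  obtain a b where ab: "a \<in> V - S" "b \<in> V - S" "(a, b) \<notin> F\<^sup>*"
    using assms(2) by (auto simp: disconnects_def connected_graph_def F_def)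
  define X where "X = F\<^sup>* `` {a}"
  have X: "X \<subseteq> V - S"
    using ab(1) unfolding X_def F_def by (auto elim: rtranclE)
  have EX: "E `` X \<subseteq> X \<union> S"
  proof clarify
    fix u v assume uv: "u \<in> X" "(u, v) \<in> E" "v \<notin> S"
    then have "(u, v) \<in> F"
      using X edges_subset by (auto simp: F_def)
    with uv(1) show "v \<in> X"
      by (auto simp: X_def intro: rtrancl_into_rtrancl)
  qed
  \<comment> \<open>For empty \<open>S\<close> the set \<open>X\<close> would be closed under
    \<open>E\<close> and miss \<open>b\<close>, against connectedness.\<close>
  have "S \<noteq> {}"
  proof
    assume "S = {}"
    then have "E `` X \<subseteq> X"
      using EX by auto
    moreover have "(a, b) \<in> E\<^sup>*" "a \<in> X" "b \<notin> X"
      using assms(1) ab by (auto simp: connected_graph_def X_def)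
    ultimately show False
      using Image_closed_trancl by blast
  qed
  then obtain s where s: "s \<in> S"
    by blast
  define G where "G = E \<inter> (V - (S - {s})) \<times> (V - (S - {s}))"
  have "S - {s} \<subset> S" "S \<subseteq> V"
    using s assms(2) by (auto simp: disconnects_def)
  then have "connected_graph (V - (S - {s})) G"
    using assms(3)[of "S - {s}"] by (auto simp: disconnects_def G_def)
  then have G: "(a, b) \<in> G\<^sup>*" "(b, a) \<in> G\<^sup>*"
    using ab by (auto simp: connected_graph_def)
  have a: "a \<in> X" and b: "b \<in> V - S - X"
    using ab by (auto simp: X_def)
  \<comment> \<open>In \<open>G\<close> the only possible exit from \<open>X\<close> is
    \<open>s\<close>. Without an edge to \<open>s\<close>, \<open>X\<close> would be closed and
    \<open>b\<close> unreachable from \<open>a\<close>.\<close>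
  have "\<exists>x\<in>X. (x, s) \<in> E"
  proof (rule ccontr)
    assume "\<not> ?thesis"
    then have "G `` X \<subseteq> X"
      using EX by (auto simp: G_def)
    with G(1) a b show False
      using Image_closed_trancl by blast
  qed
  then obtain x where x: "x \<in> X" "(x, s) \<in> E"
    by blast
  \<comment> \<open>The same argument from the other side, along a path from \<open>b\<close> to
    \<open>a\<close>.\<close>
  have "\<exists>y\<in>V - S - X. (y, s) \<in> E"
  proof (rule ccontr)
    assume no: "\<not> ?thesis"
    have "G `` (V - S - X) \<subseteq> V - S - X"
    proof clarify
      fix u v assume uv: "(u, v) \<in> G" "u \<in> V" "u \<notin> S" "u \<notin> X"
      then have "v \<noteq> s"
        using no by (auto simp: G_def)
      moreover have "v \<notin> X"
        using uv EX edges_sym by (auto simp: G_def dest: symD)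
      ultimately show "v \<in> V - S - X"
        using uv(1) by (auto simp: G_def)
    qed
    with G(2) a b show False
      using Image_closed_trancl by blast
  qed
  then obtain y where y: "y \<in> V - S - X" "(s, y) \<in> E"
    using edges_sym by (auto dest: symD)
  show ?thesis
    using that[OF X EX x(1) y(1) s x(2) y(2)] .
qed

end

section \<open>Counting neighbours in the cut, and the final estimate\<close>

lemma min_degree_le: "x \<in> V \<Longrightarrow> min_degree V E \<le> degree E x"
  unfolding min_degree_def by (rule cINF_lower) auto

text \<open>Inclusion-exclusion: the union of the two traces lies in \<open>S\<close>, their
  intersection in \<open>A \<inter> B\<close>.\<close>

lemma sum_card_Int_le:
  assumes "finite S" "finite A" "finite B" "card (A \<inter> B) \<le> b"
  shows "card (A \<inter> S) + card (B \<inter> S) \<le> card S + b"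
proof -
  have "card (A \<inter> S) + card (B \<inter> S) = card ((A \<inter> S) \<union> (B \<inter> S)) + card ((A \<inter> S) \<inter> (B \<inter> S))"
    using assms by (intro card_Un_Int) auto
  also have "\<dots> \<le> card S + card (A \<inter> B)"
    using assms by (intro add_mono card_mono) auto
  finally show ?thesis
    using assms(4) by simp
qed

theorem theorem3p2:
  fixes V :: "'a set" and E :: "'a rel" and \<beta> :: nat
  assumes "locally_finite_graph V E"
    and "connected_graph V E"
    and "\<not> complete_graph V E"
    and "\<And>x y. x \<in> V \<Longrightarrow> y \<in> V \<Longrightarrow> graph_dist E x y = 2 \<Longrightarrow> card (common_neighbors E x y) \<le> \<beta>"
  shows "real (connectivity V E) \<ge> 2 * real (min_degree V E) * curvature_LLY2 V E - real \<beta>"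
proof -
  interpret locally_finite_graph V E by fact
  obtain S where S: "finite S" "disconnects V E S" "card S = connectivity V E"
    "\<And>T. T \<subset> S \<Longrightarrow> \<not> disconnects V E T"
    using minimum_cut[OF assms(3)] by metis
  obtain X x y s where X: "X \<subseteq> V - S" "E `` X \<subseteq> X \<union> S" "x \<in> X" "y \<in> V - S - X" "s \<in> S"
    and s: "(x, s) \<in> E" "(s, y) \<in> E"
    using minimal_cut_split[OF assms(2) S(2,4)] by metis
  have V: "x \<in> V" "y \<in> V"
    using X by auto
  have dist: "graph_dist E x y = 2"
    using X s by (intro graph_dist_eq_2I) auto
  have disj: "X \<inter> S = {}"
    using X(1) by auto
  define a where "a = card (E `` {x} \<inter> S)"
  define b where "b = card (E `` {y} \<inter> S)"
  have ab: "a + b \<le> connectivity V E + \<beta>"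
    unfolding a_def b_def S(3)[symmetric]
    using assms(4)[OF V dist] locally_finite V S(1)
    by (intro sum_card_Int_le) (auto simp: common_neighbors_def)
  \<comment> \<open>Degree 0 is harmless: the quotient is then 0 by convention.\<close>
  have div: "real (min_degree V E) * (real k / real (degree E z)) \<le> real k" if "z \<in> V" for z k
    using min_degree_le[OF that, of E]
    by (cases "degree E z = 0") (auto simp: field_simps intro: mult_left_mono)
  have "2 * real (min_degree V E) * curvature_LLY2 V E
      \<le> 2 * real (min_degree V E) * ((real a / real (degree E x) + real b / real (degree E y)) / 2)"
    using curvature_LLY2_le[OF assms(2) V dist]
      curvature_LLY_le_cut[OF assms(2) _ X(2-4) V(1) s] X(1) disj
    unfolding a_def b_def by (intro mult_left_mono) auto
  also have "\<dots> \<le> real a + real b"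
    using div[OF V(1), of a] div[OF V(2), of b] by (simp add: distrib_left)
  also have "\<dots> \<le> real (connectivity V E) + real \<beta>"
    using ab by linarith
  finally show ?thesis
    by simp
qed

end
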